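(* Let $\Omega\subset\mathbb{R}^N$, $N\ge 2$, be a region satisfying (B2), let $\{b_j:j\ge1\}$ be a sequence of $\Delta$-orthonormal DBS eigenfunctions constructed as in the context with DBS eigenvalues $q_j$, and put $h_j:=\Delta b_j$, $w_j:=\sqrt{q_j|\partial\Omega|}\,D_\nu b_j$. Then the Poisson kernel $P(x,z)$ has the singular value representation $$P(x,z)=|\partial\Omega|^{-1/2}\sum_{j=1}^\infty\frac{1}{\sqrt{q_j}}\,h_j(x)\,w_j(z)=\sum_{j=1}^\infty\frac{1}{q_j}\,\Delta b_j(x)\,\Delta b_j(z)$$ for $(x,z)\in\Omega\times\partial\Omega$.
   Context: A region is a nonempty connected open subset of $\mathbb{R}^N$. All functions are real valued and derivatives are weak. (B1): $\Omega$ is bounded and $\partial\Omega$ is the union of a finite number of disjoint closed Lipschitz surfaces, each having finite surface area. $\sigma$ is $(N-1)$-dimensional Hausdorff measure on $\partial\Omega$, $|\partial\Omega|:=\sigma(\partial\Omega)$, $\nu$ is the outward unit normal, $\gamma$ the boundary trace on $H^1(\Omega)$. $H_0(\Delta,\Omega)=\{u\in H_0^1(\Omega):\Delta u\in L^2(\Omega)\}$, where $\Delta$ is the weak Laplacian ($\int_\Omega \varphi\,\Delta u\,dx=-\int_\Omega\nabla u\cdot\nabla\varphi\,dx$ for all $\varphi\in C_c^1(\Omega)$). It is a Hilbert space with inner product $[u,v]_\Delta:=a(u,v):=\int_\Omega\Delta u\,\Delta v\,dx$ and norm $\|u\|_\Delta$. "$\Delta$-orthonormal" refers to $[\cdot,\cdot]_\Delta$.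 For $u\in H_0(\Delta,\Omega)$, $D_\nu u\in L^2(\partial\Omega,d\sigma)$ is the normal derivative determined by $\int_{\partial\Omega}\gamma(v)D_\nu u\,d\sigma=\int_\Omega(\nabla u\cdot\nabla v+v\Delta u)\,dx$ for all $v\in H^1(\Omega)$. (B2): (B1) holds and $D_\nu$ is a compact mapping of $H_0(\Delta,\Omega)$ into $L^2(\partial\Omega,d\sigma)$. A DBS (Dirichlet Biharmonic Steklov) eigenvalue/eigenfunction is a pair $(q,b)\in\mathbb{R}\times H_0(\Delta,\Omega)$ with $b\ne 0$ and $\int_\Omega\Delta b\,\Delta v\,dx=q\int_{\partial\Omega}D_\nu b\,D_\nu v\,d\sigma$ for all $v\in H_0(\Delta,\Omega)$. Construction of $\{b_j\}$: put $\mathcal{M}(u):=\int_{\partial\Omega}|D_\nu u|^2\,d\sigma$. For $k=1,2,\dots$, given $b_1,\dots,b_{k-1}$, let $C_k:=\{u\in H_0(\Delta,\Omega):\|u\|_\Delta\le 1,\ a(u,b_j)=0\text{ for }1\le j\le k-1\}$, $\beta_k:=\sup_{C_k}\mathcal{M}$, and let $b_k\in C_k$ be a maximizer of $\mathcal{M}$ on $C_k$. The $b_k$ are $\Delta$-orthonormal DBS eigenfunctions with eigenvalues $q_k=1/\beta_k$. The functions $h_j=\Delta b_j$ are harmonic on $\Omega$ and represented by their $C^\infty$ versions there. On $\partial\Omega$, $\Delta b_j$ denotes the boundary value given by the DBS boundary condition $\Delta b_j=q_jD_\nu b_j=\sqrt{q_j/|\partial\Omega|}\,w_j$. $L^2_H(\Omega)$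 (the harmonic Bergman space) is the space of all $u\in L^2(\Omega)$ with $\int_\Omega u\,\Delta v\,dx=0$ for all $v\in C_c^2(\Omega)$. The harmonic extension operator $E_H:L^2(\partial\Omega,d\sigma)\to L^2_H(\Omega)$ is $$E_Hg(x):=\sqrt{|\partial\Omega|}\sum_{j=1}^\infty\frac{\hat g_j}{\sqrt{q_j}}h_j(x),\qquad \hat g_j:=|\partial\Omega|^{-1}\int_{\partial\Omega}g\,w_j\,d\sigma .$$ The Poisson kernel is the function $P:\Omega\times\partial\Omega\to[0,\infty]$ such that $E_Hg(x)=\int_{\partial\Omega}P(x,z)\,g(z)\,d\sigma(z)$ for $x\in\Omega$ and $g\in L^2(\partial\Omega,d\sigma)$. *)

theory Defs
  imports "HOL-Analysis.Analysis"
begin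

section \<open>Square-integrable functions\<close>

text \<open>Elements of function spaces are represented by functions on the whole ambient type; only
  their values on the space of the measure, up to null sets, matter.\<close>

definition L2 :: "'a measure \<Rightarrow> ('a \<Rightarrow> real) set" where
  "L2 M = {f \<in> borel_measurable M. integrable M (\<lambda>x. (f x)\<^sup>2)}"

definition L2_tendsto :: "'a measure \<Rightarrow> (nat \<Rightarrow> 'a \<Rightarrow> real) \<Rightarrow> ('a \<Rightarrow> real) \<Rightarrow> bool" where
  "L2_tendsto M F f \<longleftrightarrow>
     (\<forall>n. F n \<in> L2 M) \<and> f \<in> L2 M \<and> (\<lambda>n. \<integral>x. (F n x - f x)\<^sup>2 \<partial>M) \<longlonglongrightarrow> 0"

definition L2_sums :: "'a measure \<Rightarrow> (nat \<Rightarrow> 'a \<Rightarrow> real) \<Rightarrow> ('a \<Rightarrow> real) \<Rightarrow> bool" where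
  "L2_sums M f s \<longleftrightarrow> L2_tendsto M (\<lambda>n x. \<Sum>j<n. f j x) s"


section \<open>Hausdorff measure\<close>

text \<open>The constant is the usual normalisation, under which the Hausdorff measure of dimension
  \<open>DIM('a)\<close> is Lebesgue measure. Boundedness is needed because \<^const>\<open>diameter\<close> is only
  meaningful for bounded sets.\<close>

definition hausdorff_premeasure :: "real \<Rightarrow> real \<Rightarrow> 'a::euclidean_space set \<Rightarrow> ennreal" where
  "hausdorff_premeasure s \<delta> A =
     (INF U\<in>{U :: nat \<Rightarrow> 'a set. (\<forall>i. bounded (U i) \<and> diameter (U i) \<le> \<delta>) \<and> A \<subseteq> (\<Union>i. U i)}.
        \<Sum>i. ennreal (unit_ball_vol s * (diameter (U i) / 2) powr s))"

definition hausdorff_outer :: "real \<Rightarrow> 'a::euclidean_space set \<Rightarrow> ennreal" where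
  "hausdorff_outer s A = (SUP \<delta>\<in>{0<..}. hausdorff_premeasure s \<delta> A)"

definition hausdorff_measure :: "real \<Rightarrow> 'a::euclidean_space measure" where
  "hausdorff_measure s = measure_of UNIV (sets borel) (hausdorff_outer s)"

definition boundary_measure :: "'a::euclidean_space set \<Rightarrow> 'a measure" where
  "boundary_measure \<Omega> =
     restrict_space (hausdorff_measure (real (DIM('a) - 1))) (frontier \<Omega>)"

definition boundary_area :: "'a::euclidean_space set \<Rightarrow> real" where
  "boundary_area \<Omega> = measure (boundary_measure \<Omega>) (frontier \<Omega>)"


section \<open>Regions\<close>

definition region :: "'a::euclidean_space set \<Rightarrow> bool" where
  "region \<Omega> \<longleftrightarrow> \<Omega> \<noteq> {} \<and> connected \<Omega> \<and> open \<Omega>"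

text \<open>A compact connected set without boundary points that near each of its points is the graph
  of a Lipschitz function over a hyperplane; \<open>x - (x \<bullet> n) *\<^sub>R n\<close> is the projection of \<open>x\<close> onto
  the hyperplane orthogonal to the unit vector \<open>n\<close>.\<close>

definition closed_lipschitz_surface :: "'a::euclidean_space set \<Rightarrow> bool" where
  "closed_lipschitz_surface S \<longleftrightarrow>
     S \<noteq> {} \<and> compact S \<and> connected S \<and>
     (\<forall>p\<in>S. \<exists>n r L f. norm n = 1 \<and> r > 0 \<and> L-lipschitz_on {y. y \<bullet> n = 0} f \<and>
        S \<inter> ball p r = {x \<in> ball p r. x \<bullet> n = f (x - (x \<bullet> n) *\<^sub>R n)})"

definition B1 :: "'a::euclidean_space set \<Rightarrow> bool" where
  "B1 \<Omega> \<longleftrightarrow> bounded \<Omega> \<and>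
     (\<exists>\<S>. finite \<S> \<and> disjoint \<S> \<and> frontier \<Omega> = \<Union>\<S> \<and>
        (\<forall>S\<in>\<S>. closed_lipschitz_surface S \<and>
                emeasure (hausdorff_measure (real (DIM('a) - 1))) S < \<infinity>))"


section \<open>Weak derivatives and Sobolev spaces\<close>

definition partial :: "'a::euclidean_space \<Rightarrow> ('a \<Rightarrow> real) \<Rightarrow> 'a \<Rightarrow> real" where
  "partial e f x = frechet_derivative f (at x) e"

definition grad :: "('a::euclidean_space \<Rightarrow> real) \<Rightarrow> 'a \<Rightarrow> 'a" where
  "grad f x = (\<Sum>e\<in>Basis. partial e f x *\<^sub>R e)"

text \<open>\<open>k\<close> times continuously differentiable on an open set.\<close>

primrec Ck_on :: "nat \<Rightarrow> 'a::euclidean_space set \<Rightarrow> ('a \<Rightarrow> real) \<Rightarrow> bool" where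
  "Ck_on 0 S f \<longleftrightarrow> continuous_on S f"
| "Ck_on (Suc k) S f \<longleftrightarrow>
     (\<forall>x\<in>S. f differentiable (at x)) \<and> (\<forall>e\<in>Basis. Ck_on k S (partial e f))"

definition smooth_on :: "'a::euclidean_space set \<Rightarrow> ('a \<Rightarrow> real) \<Rightarrow> bool" where
  "smooth_on S f \<longleftrightarrow> (\<forall>k. Ck_on k S f)"

definition Cc1 :: "'a::euclidean_space set \<Rightarrow> ('a \<Rightarrow> real) set" where
  "Cc1 \<Omega> = {\<phi>. Ck_on 1 UNIV \<phi> \<and> (\<exists>K. compact K \<and> K \<subseteq> \<Omega> \<and> (\<forall>x. x \<notin> K \<longrightarrow> \<phi> x = 0))}"

definition has_weak_gradient ::
  "'a::euclidean_space set \<Rightarrow> ('a \<Rightarrow> real) \<Rightarrow> ('a \<Rightarrow> 'a) \<Rightarrow> bool" where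
  "has_weak_gradient \<Omega> u G \<longleftrightarrow>
     G \<in> borel_measurable (lebesgue_on \<Omega>) \<and>
     integrable (lebesgue_on \<Omega>) (\<lambda>x. (norm (G x))\<^sup>2) \<and>
     (\<forall>\<phi>\<in>Cc1 \<Omega>. \<forall>e\<in>Basis.
        (\<integral>x. u x * partial e \<phi> x \<partial>lebesgue_on \<Omega>) = - (\<integral>x. (G x \<bullet> e) * \<phi> x \<partial>lebesgue_on \<Omega>))"

definition H1 :: "'a::euclidean_space set \<Rightarrow> ('a \<Rightarrow> real) set" where
  "H1 \<Omega> = {u \<in> L2 (lebesgue_on \<Omega>). \<exists>G. has_weak_gradient \<Omega> u G}"

definition weak_grad :: "'a::euclidean_space set \<Rightarrow> ('a \<Rightarrow> real) \<Rightarrow> 'a \<Rightarrow> 'a" where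
  "weak_grad \<Omega> u = (SOME G. has_weak_gradient \<Omega> u G)"

definition H1_norm :: "'a::euclidean_space set \<Rightarrow> ('a \<Rightarrow> real) \<Rightarrow> real" where
  "H1_norm \<Omega> u = sqrt ((\<integral>x. (u x)\<^sup>2 \<partial>lebesgue_on \<Omega>) +
                       (\<integral>x. (norm (weak_grad \<Omega> u x))\<^sup>2 \<partial>lebesgue_on \<Omega>))"

definition H01 :: "'a::euclidean_space set \<Rightarrow> ('a \<Rightarrow> real) set" where
  "H01 \<Omega> = {u \<in> H1 \<Omega>. \<exists>\<phi>. (\<forall>n. \<phi> n \<in> Cc1 \<Omega>) \<and>
                (\<lambda>n. H1_norm \<Omega> (\<lambda>x. \<phi> n x - u x)) \<longlonglongrightarrow> 0}"

text \<open>The \<open>L\<^sup>2\<close> weak Laplacian.\<close>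

definition has_weak_laplacian ::
  "'a::euclidean_space set \<Rightarrow> ('a \<Rightarrow> real) \<Rightarrow> ('a \<Rightarrow> real) \<Rightarrow> bool" where
  "has_weak_laplacian \<Omega> u f \<longleftrightarrow>
     f \<in> L2 (lebesgue_on \<Omega>) \<and>
     (\<forall>\<phi>\<in>Cc1 \<Omega>. (\<integral>x. \<phi> x * f x \<partial>lebesgue_on \<Omega>) =
                  - (\<integral>x. weak_grad \<Omega> u x \<bullet> grad \<phi> x \<partial>lebesgue_on \<Omega>))"

definition weak_lap :: "'a::euclidean_space set \<Rightarrow> ('a \<Rightarrow> real) \<Rightarrow> 'a \<Rightarrow> real" where
  "weak_lap \<Omega> u = (SOME f. has_weak_laplacian \<Omega> u f)"

definition H0_lap :: "'a::euclidean_space set \<Rightarrow> ('a \<Rightarrow> real) set" where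
  "H0_lap \<Omega> = {u \<in> H01 \<Omega>. \<exists>f. has_weak_laplacian \<Omega> u f}"

definition lap_inner :: "'a::euclidean_space set \<Rightarrow> ('a \<Rightarrow> real) \<Rightarrow> ('a \<Rightarrow> real) \<Rightarrow> real" where
  "lap_inner \<Omega> u v = (\<integral>x. weak_lap \<Omega> u x * weak_lap \<Omega> v x \<partial>lebesgue_on \<Omega>)"

definition lap_norm :: "'a::euclidean_space set \<Rightarrow> ('a \<Rightarrow> real) \<Rightarrow> real" where
  "lap_norm \<Omega> u = sqrt (lap_inner \<Omega> u u)"


section \<open>Trace and normal derivative\<close>

text \<open>The trace is the extension by \<open>H\<^sup>1\<close>-continuity of the restriction to the boundary of
  functions that are Lipschitz on the closure.\<close>

definition has_trace ::
  "'a::euclidean_space set \<Rightarrow> ('a \<Rightarrow> real) \<Rightarrow> ('a \<Rightarrow> real) \<Rightarrow> bool" where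
  "has_trace \<Omega> u g \<longleftrightarrow>
     (\<exists>v. (\<forall>n. \<exists>L. L-lipschitz_on (closure \<Omega>) (v n)) \<and>
          (\<lambda>n. H1_norm \<Omega> (\<lambda>x. v n x - u x)) \<longlonglongrightarrow> 0 \<and>
          L2_tendsto (boundary_measure \<Omega>) v g)"

definition bdry_trace :: "'a::euclidean_space set \<Rightarrow> ('a \<Rightarrow> real) \<Rightarrow> 'a \<Rightarrow> real" where
  "bdry_trace \<Omega> u = (SOME g. has_trace \<Omega> u g)"

definition has_normal_deriv ::
  "'a::euclidean_space set \<Rightarrow> ('a \<Rightarrow> real) \<Rightarrow> ('a \<Rightarrow> real) \<Rightarrow> bool" where
  "has_normal_deriv \<Omega> u g \<longleftrightarrow>
     g \<in> L2 (boundary_measure \<Omega>) \<and>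
     (\<forall>v\<in>H1 \<Omega>. (\<integral>z. bdry_trace \<Omega> v z * g z \<partial>boundary_measure \<Omega>) =
        (\<integral>x. weak_grad \<Omega> u x \<bullet> weak_grad \<Omega> v x + v x * weak_lap \<Omega> u x \<partial>lebesgue_on \<Omega>))"

definition normal_deriv :: "'a::euclidean_space set \<Rightarrow> ('a \<Rightarrow> real) \<Rightarrow> 'a \<Rightarrow> real" where
  "normal_deriv \<Omega> u = (SOME g. has_normal_deriv \<Omega> u g)"

text \<open>The second conjunct says that the normal derivative is a mapping into \<open>L\<^sup>2\<close> of the
  boundary, the third that this (linear) mapping is compact.\<close>

definition B2 :: "'a::euclidean_space set \<Rightarrow> bool" where
  "B2 \<Omega> \<longleftrightarrow> B1 \<Omega> \<and>
     (\<forall>u\<in>H0_lap \<Omega>. \<exists>g. has_normal_deriv \<Omega> u g) \<and>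
     (\<forall>u C. (\<forall>n::nat. u n \<in> H0_lap \<Omega> \<and> lap_norm \<Omega> (u n) \<le> C) \<longrightarrow>
        (\<exists>r g. strict_mono r \<and>
           L2_tendsto (boundary_measure \<Omega>) (\<lambda>n. normal_deriv \<Omega> (u (r n))) g))"


section \<open>Dirichlet biharmonic Steklov eigenfunctions\<close>

definition DBS_eigenpair :: "'a::euclidean_space set \<Rightarrow> real \<Rightarrow> ('a \<Rightarrow> real) \<Rightarrow> bool" where
  "DBS_eigenpair \<Omega> q b \<longleftrightarrow>
     b \<in> H0_lap \<Omega> \<and> \<not> (AE x in lebesgue_on \<Omega>. b x = 0) \<and>
     (\<forall>v\<in>H0_lap \<Omega>. (\<integral>x. weak_lap \<Omega> b x * weak_lap \<Omega> v x \<partial>lebesgue_on \<Omega>) =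
        q * (\<integral>z. normal_deriv \<Omega> b z * normal_deriv \<Omega> v z \<partial>boundary_measure \<Omega>))"

definition lap_orthonormal :: "'a::euclidean_space set \<Rightarrow> (nat \<Rightarrow> 'a \<Rightarrow> real) \<Rightarrow> bool" where
  "lap_orthonormal \<Omega> b \<longleftrightarrow> (\<forall>j k. lap_inner \<Omega> (b j) (b k) = (if j = k then 1 else 0))"

definition DBS_M :: "'a::euclidean_space set \<Rightarrow> ('a \<Rightarrow> real) \<Rightarrow> real" where
  "DBS_M \<Omega> u = (\<integral>z. \<bar>normal_deriv \<Omega> u z\<bar>\<^sup>2 \<partial>boundary_measure \<Omega>)"

text \<open>Sequences are indexed from \<open>0\<close>.\<close>

definition DBS_C ::
  "'a::euclidean_space set \<Rightarrow> (nat \<Rightarrow> 'a \<Rightarrow> real) \<Rightarrow> nat \<Rightarrow> ('a \<Rightarrow> real) set" where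
  "DBS_C \<Omega> b k =
     {u \<in> H0_lap \<Omega>. lap_norm \<Omega> u \<le> 1 \<and> (\<forall>j<k. lap_inner \<Omega> u (b j) = 0)}"

definition DBS_beta :: "'a::euclidean_space set \<Rightarrow> (nat \<Rightarrow> 'a \<Rightarrow> real) \<Rightarrow> nat \<Rightarrow> real" where
  "DBS_beta \<Omega> b k = (SUP u\<in>DBS_C \<Omega> b k. DBS_M \<Omega> u)"

definition DBS_construction ::
  "'a::euclidean_space set \<Rightarrow> (nat \<Rightarrow> 'a \<Rightarrow> real) \<Rightarrow> (nat \<Rightarrow> real) \<Rightarrow> bool" where
  "DBS_construction \<Omega> b q \<longleftrightarrow>
     (\<forall>k. b k \<in> DBS_C \<Omega> b k \<and> (\<forall>u\<in>DBS_C \<Omega> b k. DBS_M \<Omega> u \<le> DBS_M \<Omega> (b k)) \<and>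
          q k = 1 / DBS_beta \<Omega> b k)"

text \<open>The smooth version of the weak Laplacian, whose values on an open \<open>\<Omega>\<close> are uniquely
  determined. It exists when \<open>u\<close> is a DBS eigenfunction, since the Laplacian is then harmonic.\<close>

definition smooth_lap :: "'a::euclidean_space set \<Rightarrow> ('a \<Rightarrow> real) \<Rightarrow> 'a \<Rightarrow> real" where
  "smooth_lap \<Omega> u = (SOME f. has_weak_laplacian \<Omega> u f \<and> smooth_on \<Omega> f)"

text \<open>The Laplacian of a DBS eigenfunction \<open>b\<close> as a function on the closure of \<open>\<Omega>\<close>; its boundary
  values are given by the DBS boundary condition.\<close>

definition DBS_lap :: "'a::euclidean_space set \<Rightarrow> real \<Rightarrow> ('a \<Rightarrow> real) \<Rightarrow> 'a \<Rightarrow> real" where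
  "DBS_lap \<Omega> q b y = (if y \<in> frontier \<Omega> then q * normal_deriv \<Omega> b y else smooth_lap \<Omega> b y)"

definition DBS_w ::
  "'a::euclidean_space set \<Rightarrow> (nat \<Rightarrow> 'a \<Rightarrow> real) \<Rightarrow> (nat \<Rightarrow> real) \<Rightarrow> nat \<Rightarrow> 'a \<Rightarrow> real" where
  "DBS_w \<Omega> b q j z = sqrt (q j * boundary_area \<Omega>) * normal_deriv \<Omega> (b j) z"


section \<open>Harmonic extension and Poisson kernel\<close>

definition DBS_coeff ::
  "'a::euclidean_space set \<Rightarrow> (nat \<Rightarrow> 'a \<Rightarrow> real) \<Rightarrow> (nat \<Rightarrow> real) \<Rightarrow> ('a \<Rightarrow> real) \<Rightarrow> nat \<Rightarrow> real"
  where
  "DBS_coeff \<Omega> b q g j =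
     (1 / boundary_area \<Omega>) * (\<integral>z. g z * DBS_w \<Omega> b q j z \<partial>boundary_measure \<Omega>)"

definition harmonic_extension ::
  "'a::euclidean_space set \<Rightarrow> (nat \<Rightarrow> 'a \<Rightarrow> real) \<Rightarrow> (nat \<Rightarrow> real) \<Rightarrow> ('a \<Rightarrow> real) \<Rightarrow> 'a \<Rightarrow> real"
  where
  "harmonic_extension \<Omega> b q g x =
     sqrt (boundary_area \<Omega>) * (\<Sum>j. DBS_coeff \<Omega> b q g j / sqrt (q j) * smooth_lap \<Omega> (b j) x)"

text \<open>The bound on the nonnegative integral is integrability of the extended-real-valued integrand; taking \<open>g = 1\<close>,
  it forces \<open>P x\<close> to be finite almost everywhere, so that \<^const>\<open>enn2real\<close> loses nothing.\<close>

definition poisson_kernel ::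
  "'a::euclidean_space set \<Rightarrow> (nat \<Rightarrow> 'a \<Rightarrow> real) \<Rightarrow> (nat \<Rightarrow> real) \<Rightarrow> ('a \<Rightarrow> 'a \<Rightarrow> ennreal) \<Rightarrow> bool"
  where
  "poisson_kernel \<Omega> b q P \<longleftrightarrow>
     (\<forall>x\<in>\<Omega>. P x \<in> borel_measurable (boundary_measure \<Omega>) \<and>
        (\<forall>g\<in>L2 (boundary_measure \<Omega>).
           (\<integral>\<^sup>+z. P x z * ennreal \<bar>g z\<bar> \<partial>boundary_measure \<Omega>) < \<infinity> \<and>
           harmonic_extension \<Omega> b q g x =
             (\<integral>z. enn2real (P x z) * g z \<partial>boundary_measure \<Omega>)))"

end

theory Submission
  imports Defs
begin

text \<open>Fix \<open>x \<in> \<Omega>\<close> and write \<open>p = P(x,\<cdot>)\<close>. The defining property of the Poisson kernel says that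
  the functional \<open>g \<mapsto> E\<^sub>H g(x)\<close> on \<open>L\<^sup>2(\<partial>\<Omega>)\<close> is integration against \<open>p\<close>, and the claim is that \<open>p\<close> is the
  sum of its Fourier series in the functions \<open>e\<^sub>j = |\<partial>\<Omega>|\<^sup>-\<^sup>1\<^sup>/\<^sup>2 w\<^sub>j\<close>. These are orthonormal: by the
  eigenvalue equation, \<open>q\<^sub>j \<integral> D\<^sub>\<nu> b\<^sub>j D\<^sub>\<nu> b\<^sub>k d\<sigma>\<close> is \<open>[b\<^sub>j, b\<^sub>k]\<^sub>\<Delta>\<close>.

  Since \<open>p\<close> is integrable against every \<open>g \<in> L\<^sup>2\<close>, it lies in \<open>L\<^sup>2\<close> itself
  (\<open>integrable_against_L2_imp_L2\<close>). Taking \<open>g = w\<^sub>k\<close>, the series for \<open>E\<^sub>H g(x)\<close> has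
  a single nonzero term, which identifies the Fourier coefficient as
  \<open>c\<^sub>k = \<integral> p e\<^sub>k d\<sigma> = h\<^sub>k(x) / \<surd>q\<^sub>k\<close> (\<open>harmonic_extension_DBS_w\<close>).
  Taking \<open>g = p\<close>, the series becomes \<open>\<Sum> c\<^sub>j\<^sup>2\<close>, so that \<open>\<integral> p\<^sup>2 d\<sigma> = \<Sum> c\<^sub>j\<^sup>2\<close>. This is Parseval's
  identity for \<open>p\<close>, and it forces the Fourier series of \<open>p\<close> to converge to \<open>p\<close>
  (\<open>L2_sums_if_Parseval\<close>). Thus the representation formula itself places
  \<open>p\<close> in the closed span of the \<open>w\<^sub>j\<close>.

  Both displayed series have the terms \<open>h\<^sub>j(x) D\<^sub>\<nu> b\<^sub>j(z)\<close>, because \<open>\<Delta> b\<^sub>j = q\<^sub>j D\<^sub>\<nu> b\<^sub>j\<close> on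
  the boundary.\<close>

section \<open>The space of square-integrable functions\<close>

lemma L2_mult_integrable:
  assumes "f \<in> L2 M" "g \<in> L2 M"
  shows "integrable M (\<lambda>x. f x * g x)"
proof (rule Bochner_Integration.integrable_bound)
  show "integrable M (\<lambda>x. (f x)\<^sup>2 + (g x)\<^sup>2)"
    using assms by (auto simp: L2_def)
  show "(\<lambda>x. f x * g x) \<in> borel_measurable M"
    using assms by (auto simp: L2_def)
  have "\<bar>a * b\<bar> \<le> a\<^sup>2 + b\<^sup>2" for a b :: real
  proof -
    have "2 * (\<bar>a\<bar> * \<bar>b\<bar>) \<le> a\<^sup>2 + b\<^sup>2"
      using sum_squares_bound[of "\<bar>a\<bar>" "\<bar>b\<bar>"] by (simp add: mult_ac)
    moreover have "0 \<le> \<bar>a\<bar> * \<bar>b\<bar>"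
      by simp
    ultimately show ?thesis
      unfolding abs_mult by linarith
  qed
  then show "AE x in M. norm (f x * g x) \<le> norm ((f x)\<^sup>2 + (g x)\<^sup>2)"
    by auto
qed

lemma L2_cmult: "f \<in> L2 M \<Longrightarrow> (\<lambda>x. c * f x) \<in> L2 M"
  by (auto simp: L2_def power_mult_distrib)

lemma L2_add:
  assumes "f \<in> L2 M" "g \<in> L2 M"
  shows "(\<lambda>x. f x + g x) \<in> L2 M"
  using assms L2_mult_integrable[OF assms]
  by (auto simp: L2_def power2_sum mult.assoc)

lemma L2_sum:
  assumes "\<And>j. j \<in> I \<Longrightarrow> f j \<in> L2 M"
  shows "(\<lambda>x. \<Sum>j\<in>I. f j x) \<in> L2 M"
  using assms
proof (induction I rule: infinite_finite_induct)
  case (insert j I)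
  then show ?case by (simp add: L2_add)
qed (auto simp: L2_def)

lemma L2_cong:
  assumes "\<And>x. x \<in> space M \<Longrightarrow> f x = g x"
  shows "f \<in> L2 M \<longleftrightarrow> g \<in> L2 M"
  unfolding L2_def
  using assms measurable_cong[of M f g borel]
    Bochner_Integration.integrable_cong[OF refl, of M "\<lambda>x. (f x)\<^sup>2" "\<lambda>x. (g x)\<^sup>2"]
  by simp

lemma L2_sums_cong:
  assumes "\<And>j x. x \<in> space M \<Longrightarrow> f j x = g j x"
  shows "L2_sums M f s \<longleftrightarrow> L2_sums M g s"
proof -
  have "(\<lambda>x. \<Sum>j<n. f j x) \<in> L2 M \<longleftrightarrow> (\<lambda>x. \<Sum>j<n. g j x) \<in> L2 M" for n
    by (rule L2_cong) (simp add: assms)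
  moreover have "(\<integral>x. ((\<Sum>j<n. f j x) - s x)\<^sup>2 \<partial>M) = (\<integral>x. ((\<Sum>j<n. g j x) - s x)\<^sup>2 \<partial>M)" for n
    by (rule Bochner_Integration.integral_cong) (simp_all add: assms)
  ultimately show ?thesis
    by (simp add: L2_sums_def L2_tendsto_def)
qed

lemma (in finite_measure) bounded_in_L2:
  assumes "f \<in> borel_measurable M" "\<And>x. \<bar>f x\<bar> \<le> B"
  shows "f \<in> L2 M"
  unfolding L2_def
proof (intro CollectI conjI)
  show "integrable M (\<lambda>x. (f x)\<^sup>2)"
    using assms power_mono[OF assms(2), of _ 2]
    by (intro integrable_const_bound[where B = "B\<^sup>2"]) auto
qed fact

text \<open>A gliding hump argument for the converse of Hoelder's inequality. Suppose the truncations
  \<open>t\<^sub>m = min f m\<close> had unbounded norms, and choose truncations \<open>u\<^sub>n\<close> with \<open>\<parallel>u\<^sub>n\<parallel> \<ge> 4\<^sup>n\<close>. Then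
  \<open>g = (\<Sum>n. 4\<^sup>-\<^sup>n (u\<^sub>n / \<parallel>u\<^sub>n\<parallel>)\<^sup>2)\<^sup>1\<^sup>/\<^sup>2\<close> is in \<open>L\<^sup>2\<close> and dominates every
  \<open>2\<^sup>-\<^sup>n u\<^sub>n / \<parallel>u\<^sub>n\<parallel>\<close>, so \<open>\<integral> f g \<ge> 2\<^sup>-\<^sup>n \<parallel>u\<^sub>n\<parallel> \<ge> 2\<^sup>n\<close> for all \<open>n\<close>. Combining
  the humps by a square sum makes the squared norm of \<open>g\<close> additive in the humps.\<close>

lemma (in finite_measure) integrable_against_L2_imp_L2:
  assumes f [measurable]: "f \<in> borel_measurable M"
    and nonneg: "\<And>x. 0 \<le> f x"
    and int: "\<And>g. g \<in> L2 M \<Longrightarrow> integrable M (\<lambda>x. f x * g x)"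
  shows "f \<in> L2 M"
proof (rule ccontr)
  assume "f \<notin> L2 M"
  define t where "t m x = min (f x) (real m)" for m x
  have t_meas [measurable]: "t m \<in> borel_measurable M" for m
    unfolding t_def by measurable
  have t_nonneg: "0 \<le> t m x" for m x
    using nonneg by (simp add: t_def)
  have t_L2: "t m \<in> L2 M" for m
    by (rule bounded_in_L2[where B = "real m"]) (use nonneg in \<open>auto simp: t_def\<close>)
  define N where "N m = (\<integral>x. (t m x)\<^sup>2 \<partial>M)" for m
  have N_nn: "(\<integral>\<^sup>+x. ennreal ((t m x)\<^sup>2) \<partial>M) = ennreal (N m)" for m
    unfolding N_def using t_L2 by (intro nn_integral_eq_integral) (auto simp: L2_def)
  have infinite_norm: "(\<integral>\<^sup>+x. ennreal ((f x)\<^sup>2) \<partial>M) = \<infinity>"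
  proof (rule ccontr)
    assume "(\<integral>\<^sup>+x. ennreal ((f x)\<^sup>2) \<partial>M) \<noteq> \<infinity>"
    then have "integrable M (\<lambda>x. (f x)\<^sup>2)"
      by (intro integrableI_nonneg) (auto simp: less_top[symmetric])
    with \<open>f \<notin> L2 M\<close> show False
      by (simp add: L2_def)
  qed
  have f_eq: "ennreal ((f x)\<^sup>2) = (SUP m. ennreal ((t m x)\<^sup>2))" for x
  proof (rule antisym)
    obtain m where "f x \<le> real m"
      using real_arch_simple by blast
    then have "t m x = f x" by (simp add: t_def)
    then show "ennreal ((f x)\<^sup>2) \<le> (SUP m. ennreal ((t m x)\<^sup>2))"
      by (metis SUP_upper UNIV_I)
    show "(SUP m. ennreal ((t m x)\<^sup>2)) \<le> ennreal ((f x)\<^sup>2)"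
      using t_nonneg by (intro SUP_least ennreal_leI power_mono) (auto simp: t_def)
  qed
  have "incseq (\<lambda>m x. ennreal ((t m x)\<^sup>2))"
    using t_nonneg by (intro monoI le_funI ennreal_leI power_mono) (auto simp: t_def)
  then have "(\<integral>\<^sup>+x. ennreal ((f x)\<^sup>2) \<partial>M) = (SUP m. ennreal (N m))"
    unfolding f_eq N_nn[symmetric] by (intro nn_integral_monotone_convergence_SUP) auto
  then have SUP_N: "(SUP m. ennreal (N m)) = top"
    using infinite_norm by simp
  have "\<exists>m. 16 ^ n \<le> N m" for n
  proof -
    have "ennreal (16 ^ n) < (SUP m. ennreal (N m))"
      by (simp add: SUP_N)
    then obtain m where "ennreal (16 ^ n) < ennreal (N m)"
      by (auto simp: less_SUP_iff)
    then show ?thesis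
      by (metis ennreal_less_iff less_imp_le zero_le_numeral zero_le_power)
  qed
  then obtain k where k: "16 ^ n \<le> N (k n)" for n
    by metis
  have N_pos: "0 < N (k n)" for n
    using k[of n] by (meson less_le_trans zero_less_numeral zero_less_power)
  define G where "G x = (\<Sum>n. ennreal ((1/4) ^ n * ((t (k n) x)\<^sup>2 / N (k n))))" for x
  have [measurable]: "G \<in> borel_measurable M"
    unfolding G_def by measurable
  have "(\<integral>\<^sup>+x. G x \<partial>M) =
      (\<Sum>n. (\<integral>\<^sup>+x. ennreal ((1/4) ^ n / N (k n)) * ennreal ((t (k n) x)\<^sup>2) \<partial>M))"
    unfolding G_def using N_pos
    by (subst nn_integral_suminf) (auto simp: ennreal_mult[symmetric] less_imp_le)
  also have "\<dots> = (\<Sum>n. ennreal ((1/4) ^ n))"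
  proof (rule suminf_cong)
    fix n
    have "(\<integral>\<^sup>+x. ennreal ((1/4) ^ n / N (k n)) * ennreal ((t (k n) x)\<^sup>2) \<partial>M)
        = ennreal ((1/4) ^ n / N (k n)) * ennreal (N (k n))"
      by (simp add: nn_integral_cmult N_nn)
    also have "\<dots> = ennreal ((1/4) ^ n)"
      using N_pos[of n] by (simp add: ennreal_mult[symmetric])
    finally show "(\<integral>\<^sup>+x. ennreal ((1/4) ^ n / N (k n)) * ennreal ((t (k n) x)\<^sup>2) \<partial>M)
        = ennreal ((1/4) ^ n)" .
  qed
  also have "\<dots> = ennreal (\<Sum>n. (1/4) ^ n)"
    by (rule suminf_ennreal2) (auto intro: summable_geometric)
  finally have G_int: "(\<integral>\<^sup>+x. G x \<partial>M) < \<infinity>"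
    by simp
  then have G_fin: "AE x in M. G x \<noteq> \<infinity>"
    by (intro nn_integral_PInf_AE) auto
  define g where "g x = sqrt (enn2real (G x))" for x
  have [measurable]: "g \<in> borel_measurable M"
    unfolding g_def by measurable
  have "(\<integral>\<^sup>+x. ennreal ((g x)\<^sup>2) \<partial>M) = (\<integral>\<^sup>+x. G x \<partial>M)"
    using G_fin by (intro nn_integral_cong_AE) (auto simp: g_def less_top[symmetric])
  then have "g \<in> L2 M"
    using G_int by (auto simp: L2_def intro!: integrableI_nonneg)
  then have fg: "integrable M (\<lambda>x. f x * g x)"
    by (rule int)
  have "2 ^ n \<le> (\<integral>x. f x * g x \<partial>M)" for n
  proof -
    define s where "s = sqrt (N (k n))"
    have s_pos: "0 < s" and s_sq: "s * s = N (k n)"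
      using N_pos[of n] by (auto simp: s_def)
    have "4 ^ n = sqrt (16 ^ n)"
      by (simp add: real_sqrt_power)
    also have "\<dots> \<le> s"
      unfolding s_def using k by (rule real_sqrt_le_mono)
    finally have "(1/2) ^ n / s * N (k n) \<ge> (1/2) ^ n * 4 ^ n"
      using s_pos by (simp add: s_sq[symmetric])
    then have "2 ^ n \<le> (1/2) ^ n / s * N (k n)"
      by (simp add: power_mult_distrib[symmetric])
    also have "\<dots> = (\<integral>x. (1/2) ^ n / s * (t (k n) x)\<^sup>2 \<partial>M)"
      by (simp add: N_def)
    also have "\<dots> \<le> (\<integral>x. f x * g x \<partial>M)"
    proof (rule integral_mono_AE)
      show "integrable M (\<lambda>x. (1/2) ^ n / s * (t (k n) x)\<^sup>2)"
        using t_L2[of "k n"] by (auto simp: L2_def)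
      show "AE x in M. (1/2) ^ n / s * (t (k n) x)\<^sup>2 \<le> f x * g x"
        using G_fin
      proof eventually_elim
        case (elim x)
        have quarter: "(1/4 :: real) ^ n = (1/2) ^ n * (1/2) ^ n"
          by (simp flip: power_mult_distrib)
        let ?T = "\<lambda>n. ennreal ((1/4) ^ n * ((t (k n) x)\<^sup>2 / N (k n)))"
        have "?T n \<le> G x"
          unfolding G_def using sum_le_suminf[of ?T "{n}"] by simp
        also have "G x = ennreal (enn2real (G x))"
          using elim by (simp add: less_top[symmetric])
        finally have "(1/4) ^ n * ((t (k n) x)\<^sup>2 / N (k n)) \<le> enn2real (G x)"
          by (simp add: ennreal_le_iff)
        moreover have "(1/4) ^ n * ((t (k n) x)\<^sup>2 / N (k n)) = ((1/2) ^ n * t (k n) x / s)\<^sup>2"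
          unfolding quarter s_sq[symmetric] by (simp add: power2_eq_square mult_ac)
        ultimately have "(1/2) ^ n * t (k n) x / s \<le> g x"
          unfolding g_def by (simp add: real_le_rsqrt)
        moreover have "t (k n) x \<le> f x"
          by (simp add: t_def)
        ultimately have "t (k n) x * ((1/2) ^ n * t (k n) x / s) \<le> f x * g x"
          using t_nonneg[of "k n" x] nonneg[of x] s_pos by (intro mult_mono) auto
        then show ?case
          by (simp add: power2_eq_square mult_ac)
      qed
    qed fact
    finally show ?thesis .
  qed
  moreover obtain n where "(\<integral>x. f x * g x \<partial>M) < 2 ^ n"
    using real_arch_pow[of 2] by auto
  ultimately show False
    by (meson not_less)
qed

section \<open>Fourier series in an orthonormal sequence\<close>

context
  fixes M :: "'a measure" and p :: "'a \<Rightarrow> real" and e :: "nat \<Rightarrow> 'a \<Rightarrow> real" and c :: "nat \<Rightarrow> real"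
  assumes p: "p \<in> L2 M"
    and e: "\<And>j. e j \<in> L2 M"
    and orthonormal: "\<And>j k. (\<integral>x. e j x * e k x \<partial>M) = (if j = k then 1 else 0)"
    and c: "\<And>j. (\<integral>x. p x * e j x \<partial>M) = c j"
begin

lemma L2_partial_Fourier_sum: "(\<lambda>x. \<Sum>j<n. c j * e j x) \<in> L2 M"
  by (intro L2_sum L2_cmult e)

lemma L2_error_partial_Fourier_sum:
  "(\<integral>x. ((\<Sum>j<n. c j * e j x) - p x)\<^sup>2 \<partial>M) = (\<integral>x. (p x)\<^sup>2 \<partial>M) - (\<Sum>j<n. (c j)\<^sup>2)"
proof -
  define S where "S x = (\<Sum>j<n. c j * e j x)" for x
  have S: "S \<in> L2 M"
    unfolding S_def[abs_def] by (rule L2_partial_Fourier_sum)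
  have pe: "integrable M (\<lambda>x. p x * e j x)" for j
    by (intro L2_mult_integrable p e)
  have ee: "integrable M (\<lambda>x. e i x * e j x)" for i j
    by (intro L2_mult_integrable e)
  have "(\<integral>x. p x * S x \<partial>M) = (\<integral>x. (\<Sum>j<n. c j * (p x * e j x)) \<partial>M)"
    by (simp add: S_def sum_distrib_left mult_ac)
  also have "\<dots> = (\<Sum>j<n. (c j)\<^sup>2)"
    by (simp add: Bochner_Integration.integral_sum pe c power2_eq_square)
  finally have pS: "(\<integral>x. p x * S x \<partial>M) = (\<Sum>j<n. (c j)\<^sup>2)" .
  have "(\<integral>x. (S x)\<^sup>2 \<partial>M) = (\<integral>x. (\<Sum>i<n. \<Sum>j<n. c i * c j * (e i x * e j x)) \<partial>M)"
    by (simp add: S_def power2_eq_square sum_product mult_ac)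
  also have "\<dots> = (\<Sum>i<n. \<Sum>j<n. c i * c j * (if i = j then 1 else 0))"
    by (simp add: Bochner_Integration.integral_sum ee orthonormal)
  also have "\<dots> = (\<Sum>j<n. (c j)\<^sup>2)"
    by (simp add: if_distrib power2_eq_square cong: if_cong)
  finally have SS: "(\<integral>x. (S x)\<^sup>2 \<partial>M) = (\<Sum>j<n. (c j)\<^sup>2)" .
  have "(\<integral>x. (S x - p x)\<^sup>2 \<partial>M) = (\<integral>x. (S x)\<^sup>2 + (p x)\<^sup>2 - 2 * (p x * S x) \<partial>M)"
    by (simp add: power2_diff mult_ac)
  also have "\<dots> = (\<integral>x. (S x)\<^sup>2 \<partial>M) + (\<integral>x. (p x)\<^sup>2 \<partial>M) - 2 * (\<integral>x. p x * S x \<partial>M)"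
    using S p L2_mult_integrable[OF p S] by (simp add: L2_def)
  finally show ?thesis
    unfolding pS SS by (simp add: S_def)
qed

lemma Bessel_summable: "summable (\<lambda>j. (c j)\<^sup>2)"
proof (rule summableI_nonneg_bounded)
  fix n
  have "0 \<le> (\<integral>x. ((\<Sum>j<n. c j * e j x) - p x)\<^sup>2 \<partial>M)"
    by simp
  then show "(\<Sum>j<n. (c j)\<^sup>2) \<le> (\<integral>x. (p x)\<^sup>2 \<partial>M)"
    by (simp add: L2_error_partial_Fourier_sum)
qed simp

text \<open>The squared error of the \<open>n\<close>-th partial sum is \<open>\<integral> p\<^sup>2\<close> less the first \<open>n\<close>
  squared coefficients, so equality of the two totals is convergence. Bessel's inequality ensures
  that the series in the assumption converges, so that its \<^const>\<open>suminf\<close> is a genuine sum.\<close>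

lemma L2_sums_if_Parseval:
  assumes "(\<integral>x. (p x)\<^sup>2 \<partial>M) = (\<Sum>j. (c j)\<^sup>2)"
  shows "L2_sums M (\<lambda>j x. c j * e j x) p"
proof -
  have "(\<lambda>n. (\<integral>x. (p x)\<^sup>2 \<partial>M) - (\<Sum>j<n. (c j)\<^sup>2))
      \<longlonglongrightarrow> (\<integral>x. (p x)\<^sup>2 \<partial>M) - (\<Sum>j. (c j)\<^sup>2)"
    by (intro tendsto_diff tendsto_const summable_LIMSEQ Bessel_summable)
  then show ?thesis
    using p L2_partial_Fourier_sum
    by (simp add: L2_sums_def L2_tendsto_def L2_error_partial_Fourier_sum assms)
qed

end

section \<open>The boundary measure and the normal derivative\<close>

lemma space_hausdorff_measure: "space (hausdorff_measure s) = UNIV"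
  by (simp add: hausdorff_measure_def space_measure_of_conv)

lemma sets_hausdorff_measure: "sets (hausdorff_measure s) = sets borel"
  unfolding hausdorff_measure_def by (metis sets.sets_measure_of_eq space_borel)

lemma space_boundary_measure: "space (boundary_measure \<Omega>) = frontier \<Omega>"
  by (simp add: boundary_measure_def space_restrict_space space_hausdorff_measure)

lemma finite_boundary_measure:
  fixes \<Omega> :: "'a::euclidean_space set"
  assumes "B1 \<Omega>"
  shows "finite_measure (boundary_measure \<Omega>)"
proof
  let ?H = "hausdorff_measure (real (DIM('a) - 1)) :: 'a measure"
  obtain \<S> where \<S>: "finite \<S>" "frontier \<Omega> = \<Union>\<S>"
    "\<And>S. S \<in> \<S> \<Longrightarrow> closed_lipschitz_surface S \<and> emeasure ?H S < \<infinity>"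
    using assms unfolding B1_def by blast
  have "S \<in> sets ?H" if "S \<in> \<S>" for S
    using \<S>(3)[OF that] by (auto simp: closed_lipschitz_surface_def sets_hausdorff_measure borel_compact)
  then have "emeasure ?H (\<Union>S\<in>\<S>. S) \<le> (\<Sum>S\<in>\<S>. emeasure ?H S)"
    by (intro emeasure_subadditive_finite) (auto simp: \<S>)
  also have "\<dots> < \<infinity>"
    using \<S> by simp
  finally have "emeasure ?H (frontier \<Omega>) \<noteq> \<infinity>"
    using \<S>(2) by simp
  moreover have "frontier \<Omega> \<inter> space ?H \<in> sets ?H"
    by (simp add: sets_hausdorff_measure space_hausdorff_measure)
  ultimately show "emeasure (boundary_measure \<Omega>) (space (boundary_measure \<Omega>)) \<noteq> \<infinity>"
    unfolding space_boundary_measure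
    by (simp add: boundary_measure_def emeasure_restrict_space)
qed

lemma normal_deriv_L2:
  assumes "B2 \<Omega>" "u \<in> H0_lap \<Omega>"
  shows "normal_deriv \<Omega> u \<in> L2 (boundary_measure \<Omega>)"
proof -
  have "\<exists>g. has_normal_deriv \<Omega> u g"
    using assms by (auto simp: B2_def)
  then have "has_normal_deriv \<Omega> u (normal_deriv \<Omega> u)"
    unfolding normal_deriv_def by (rule someI_ex)
  then show ?thesis
    by (simp add: has_normal_deriv_def)
qed

section \<open>Orthonormality of the boundary functions of the eigenfunctions\<close>

context
  fixes \<Omega> :: "'a::euclidean_space set" and b :: "nat \<Rightarrow> 'a \<Rightarrow> real" and q :: "nat \<Rightarrow> real"
  assumes B2: "B2 \<Omega>"
    and orthonormal: "lap_orthonormal \<Omega> b"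
    and eigen: "\<And>j. DBS_eigenpair \<Omega> (q j) (b j)"
begin

lemma normal_deriv_orthogonal:
  "q j * (\<integral>z. normal_deriv \<Omega> (b j) z * normal_deriv \<Omega> (b k) z \<partial>boundary_measure \<Omega>)
    = (if j = k then 1 else 0)"
  using orthonormal eigen unfolding lap_orthonormal_def lap_inner_def DBS_eigenpair_def by metis

lemma DBS_eigenvalue_pos: "0 < q j"
proof -
  have "0 \<le> (\<integral>z. normal_deriv \<Omega> (b j) z * normal_deriv \<Omega> (b j) z \<partial>boundary_measure \<Omega>)"
    by simp
  then show ?thesis
    using normal_deriv_orthogonal[of j j] by (smt (verit) mult_nonpos_nonneg)
qed

text \<open>On a boundary of measure zero all normal derivatives would vanish almost everywhere, which
  contradicts the normalisation of the eigenfunctions.\<close>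

lemma boundary_area_pos: "0 < boundary_area \<Omega>"
proof (rule ccontr)
  interpret finite_measure "boundary_measure \<Omega>"
    using B2 by (intro finite_boundary_measure) (simp add: B2_def)
  assume "\<not> 0 < boundary_area \<Omega>"
  then have "measure (boundary_measure \<Omega>) (space (boundary_measure \<Omega>)) = 0"
    using measure_nonneg[of "boundary_measure \<Omega>"]
    by (simp add: boundary_area_def space_boundary_measure less_le)
  then have "emeasure (boundary_measure \<Omega>) (space (boundary_measure \<Omega>)) = 0"
    by (simp add: emeasure_eq_measure)
  then have "AE z in boundary_measure \<Omega>. False"
    by (intro AE_I[where N = "space (boundary_measure \<Omega>)"]) auto
  then have "(\<integral>z. normal_deriv \<Omega> (b 0) z * normal_deriv \<Omega> (b 0) z \<partial>boundary_measure \<Omega>) = 0"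
    by (intro integral_eq_zero_AE) auto
  with normal_deriv_orthogonal[of 0 0] show False
    by simp
qed

lemma DBS_w_L2: "DBS_w \<Omega> b q j \<in> L2 (boundary_measure \<Omega>)"
proof -
  have "normal_deriv \<Omega> (b j) \<in> L2 (boundary_measure \<Omega>)"
    using eigen B2 by (intro normal_deriv_L2) (auto simp: DBS_eigenpair_def)
  then show ?thesis
    unfolding DBS_w_def[abs_def] by (rule L2_cmult)
qed

lemma DBS_w_orthogonal:
  "(\<integral>z. DBS_w \<Omega> b q j z * DBS_w \<Omega> b q k z \<partial>boundary_measure \<Omega>)
    = (if j = k then boundary_area \<Omega> else 0)"
proof -
  let ?I = "\<integral>z. normal_deriv \<Omega> (b j) z * normal_deriv \<Omega> (b k) z \<partial>boundary_measure \<Omega>"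
  have "(\<integral>z. DBS_w \<Omega> b q j z * DBS_w \<Omega> b q k z \<partial>boundary_measure \<Omega>) =
      (\<integral>z. (sqrt (q j * boundary_area \<Omega>) * sqrt (q k * boundary_area \<Omega>)) *
        (normal_deriv \<Omega> (b j) z * normal_deriv \<Omega> (b k) z) \<partial>boundary_measure \<Omega>)"
    by (simp add: DBS_w_def mult_ac)
  also have "\<dots> = sqrt (q j * boundary_area \<Omega>) * sqrt (q k * boundary_area \<Omega>) * ?I"
    by simp
  also have "\<dots> = (if j = k then boundary_area \<Omega> else 0)"
  proof (cases "j = k")
    case True
    then have "sqrt (q j * boundary_area \<Omega>) * sqrt (q k * boundary_area \<Omega>) * ?I
        = boundary_area \<Omega> * (q j * ?I)"
      using DBS_eigenvalue_pos[of j] boundary_area_pos by simp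
    also have "\<dots> = boundary_area \<Omega>"
      unfolding normal_deriv_orthogonal using True by simp
    finally show ?thesis using True by simp
  next
    case False
    then have "?I = 0"
      using normal_deriv_orthogonal[of j k] DBS_eigenvalue_pos[of j] by simp
    with False show ?thesis by simp
  qed
  finally show ?thesis .
qed

section \<open>Expansion of a function representing the harmonic extension at a point\<close>

lemma harmonic_extension_DBS_w:
  "harmonic_extension \<Omega> b q (DBS_w \<Omega> b q k) x =
    sqrt (boundary_area \<Omega>) * (smooth_lap \<Omega> (b k) x / sqrt (q k))"
proof -
  have "DBS_coeff \<Omega> b q (DBS_w \<Omega> b q k) j = (if j = k then 1 else 0)" for j
    using boundary_area_pos by (auto simp: DBS_coeff_def DBS_w_orthogonal)
  then have "(\<Sum>j. DBS_coeff \<Omega> b q (DBS_w \<Omega> b q k) j / sqrt (q j) * smooth_lap \<Omega> (b j) x)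
      = (\<Sum>j. if j = k then smooth_lap \<Omega> (b k) x / sqrt (q k) else 0)"
    by (intro suminf_cong) simp
  also have "\<dots> = smooth_lap \<Omega> (b k) x / sqrt (q k)"
    using sums_single[of k "\<lambda>_. smooth_lap \<Omega> (b k) x / sqrt (q k)"] by (simp add: sums_iff)
  finally show ?thesis
    by (simp add: harmonic_extension_def)
qed

text \<open>Applying the representation to the \<open>w\<^sub>j\<close> computes the Fourier coefficients of \<open>p\<close>;
  applying it to \<open>p\<close> itself yields Parseval's identity.\<close>

lemma L2_sums_representer:
  assumes p: "p \<in> L2 (boundary_measure \<Omega>)"
    and repr: "\<And>g. g \<in> L2 (boundary_measure \<Omega>) \<Longrightarrow>
      harmonic_extension \<Omega> b q g x = (\<integral>z. p z * g z \<partial>boundary_measure \<Omega>)"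
  shows "L2_sums (boundary_measure \<Omega>)
      (\<lambda>j z. smooth_lap \<Omega> (b j) x * normal_deriv \<Omega> (b j) z) p"
proof -
  let ?A = "boundary_area \<Omega>"
  define e where "e j z = 1 / sqrt ?A * DBS_w \<Omega> b q j z" for j z
  define c where "c j = smooth_lap \<Omega> (b j) x / sqrt (q j)" for j
  have e_L2: "e j \<in> L2 (boundary_measure \<Omega>)" for j
    unfolding e_def[abs_def] by (intro L2_cmult DBS_w_L2)
  have pw: "(\<integral>z. p z * DBS_w \<Omega> b q j z \<partial>boundary_measure \<Omega>) = sqrt ?A * c j" for j
    using repr[OF DBS_w_L2[of j]] by (simp add: harmonic_extension_DBS_w c_def)
  have orth: "(\<integral>z. e j z * e k z \<partial>boundary_measure \<Omega>) = (if j = k then 1 else 0)" for j k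
  proof -
    have "(\<integral>z. e j z * e k z \<partial>boundary_measure \<Omega>) =
        (\<integral>z. 1 / ?A * (DBS_w \<Omega> b q j z * DBS_w \<Omega> b q k z) \<partial>boundary_measure \<Omega>)"
      using boundary_area_pos by (simp add: e_def mult_ac)
    also have "\<dots> = (if j = k then 1 else 0)"
      using boundary_area_pos by (simp add: DBS_w_orthogonal)
    finally show ?thesis .
  qed
  have coeff: "(\<integral>z. p z * e j z \<partial>boundary_measure \<Omega>) = c j" for j
  proof -
    have "(\<integral>z. p z * e j z \<partial>boundary_measure \<Omega>) =
        (\<integral>z. 1 / sqrt ?A * (p z * DBS_w \<Omega> b q j z) \<partial>boundary_measure \<Omega>)"
      by (simp add: e_def mult_ac)
    also have "\<dots> = c j"
      using boundary_area_pos by (simp add: pw)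
    finally show ?thesis .
  qed
  have term_eq: "DBS_coeff \<Omega> b q p j / sqrt (q j) * smooth_lap \<Omega> (b j) x = 1 / sqrt ?A * (c j)\<^sup>2" for j
  proof -
    have "DBS_coeff \<Omega> b q p j = sqrt ?A / ?A * c j"
      by (simp add: DBS_coeff_def pw)
    also have "sqrt ?A / ?A = 1 / sqrt ?A"
      using boundary_area_pos by (simp add: real_div_sqrt field_simps)
    finally have "DBS_coeff \<Omega> b q p j = 1 / sqrt ?A * c j" .
    then show ?thesis
      by (simp add: c_def power2_eq_square)
  qed
  (* Bessel's inequality gives the convergence needed to move the constant through suminf. *)
  have "(\<integral>z. (p z)\<^sup>2 \<partial>boundary_measure \<Omega>) = sqrt ?A * (\<Sum>j. 1 / sqrt ?A * (c j)\<^sup>2)"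
    using repr[OF p] unfolding harmonic_extension_def term_eq power2_eq_square by simp
  also have "\<dots> = (\<Sum>j. (c j)\<^sup>2)"
    unfolding suminf_mult[OF Bessel_summable[OF p e_L2 orth coeff]]
    using boundary_area_pos by simp
  finally have "L2_sums (boundary_measure \<Omega>) (\<lambda>j z. c j * e j z) p"
    by (rule L2_sums_if_Parseval[OF p e_L2 orth coeff])
  moreover have "c j * e j z = smooth_lap \<Omega> (b j) x * normal_deriv \<Omega> (b j) z" for j z
    using boundary_area_pos DBS_eigenvalue_pos[of j]
    by (simp add: c_def e_def DBS_w_def real_sqrt_mult)
  ultimately show ?thesis
    by simp
qed

end

section \<open>The singular value representation of the Poisson kernel\<close>

theorem theorem7p2:
  fixes \<Omega> :: "'a::euclidean_space set"
    and b h w :: "nat \<Rightarrow> 'a \<Rightarrow> real"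
    and q :: "nat \<Rightarrow> real"
    and P :: "'a \<Rightarrow> 'a \<Rightarrow> ennreal"
  assumes dim: "DIM('a) \<ge> 2"
    and region: "region \<Omega>"
    and B2: "B2 \<Omega>"
    and orthonormal: "lap_orthonormal \<Omega> b"
    and eigen: "\<And>j. DBS_eigenpair \<Omega> (q j) (b j)"
    and construction: "DBS_construction \<Omega> b q"
    and h: "\<And>j. h j = smooth_lap \<Omega> (b j)"
    and w: "\<And>j. w j = (\<lambda>z. sqrt (q j * boundary_area \<Omega>) * normal_deriv \<Omega> (b j) z)"
    and P: "poisson_kernel \<Omega> b q P"
  shows "\<forall>x\<in>\<Omega>.
     (AE z in boundary_measure \<Omega>. P x z < \<infinity>) \<and>
     L2_sums (boundary_measure \<Omega>)
       (\<lambda>j z. boundary_area \<Omega> powr (- 1 / 2) * (1 / sqrt (q j) * h j x * w j z))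
       (\<lambda>z. enn2real (P x z)) \<and>
     L2_sums (boundary_measure \<Omega>)
       (\<lambda>j z. 1 / q j * DBS_lap \<Omega> (q j) (b j) x * DBS_lap \<Omega> (q j) (b j) z)
       (\<lambda>z. enn2real (P x z))"
proof (intro ballI)
  fix x
  assume x: "x \<in> \<Omega>"
  interpret finite_measure "boundary_measure \<Omega>"
    using B2 by (intro finite_boundary_measure) (simp add: B2_def)
  have P_meas [measurable]: "P x \<in> borel_measurable (boundary_measure \<Omega>)"
    and P_fin: "\<And>g. g \<in> L2 (boundary_measure \<Omega>) \<Longrightarrow>
      (\<integral>\<^sup>+z. P x z * ennreal \<bar>g z\<bar> \<partial>boundary_measure \<Omega>) < \<infinity>"
    and P_repr: "\<And>g. g \<in> L2 (boundary_measure \<Omega>) \<Longrightarrow>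
      harmonic_extension \<Omega> b q g x = (\<integral>z. enn2real (P x z) * g z \<partial>boundary_measure \<Omega>)"
    using P x unfolding poisson_kernel_def by blast+
  (* pairing with the constant 1 shows that the kernel is integrable, hence finite a.e. *)
  have "(\<lambda>_. 1) \<in> L2 (boundary_measure \<Omega>)"
    by (rule bounded_in_L2[where B = 1]) auto
  then have "(\<integral>\<^sup>+z. P x z \<partial>boundary_measure \<Omega>) < \<infinity>"
    using P_fin[of "\<lambda>_. 1"] by simp
  then have P_AE: "AE z in boundary_measure \<Omega>. P x z \<noteq> \<infinity>"
    by (intro nn_integral_PInf_AE) auto
  have p_L2: "(\<lambda>z. enn2real (P x z)) \<in> L2 (boundary_measure \<Omega>)"
  proof (rule integrable_against_L2_imp_L2)
    fix g
    assume g: "g \<in> L2 (boundary_measure \<Omega>)"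
    then have [measurable]: "g \<in> borel_measurable (boundary_measure \<Omega>)"
      by (simp add: L2_def)
    have "(\<integral>\<^sup>+z. ennreal (norm (enn2real (P x z) * g z)) \<partial>boundary_measure \<Omega>)
        = (\<integral>\<^sup>+z. P x z * ennreal \<bar>g z\<bar> \<partial>boundary_measure \<Omega>)"
      using P_AE
      by (intro nn_integral_cong_AE) (auto simp: abs_mult ennreal_mult less_top[symmetric])
    then show "integrable (boundary_measure \<Omega>) (\<lambda>z. enn2real (P x z) * g z)"
      using P_fin[OF g] by (intro integrableI_bounded) simp_all
  qed simp_all
  note pos = boundary_area_pos[OF B2 orthonormal eigen] DBS_eigenvalue_pos[OF B2 orthonormal eigen]
  note expansion = L2_sums_representer[OF B2 orthonormal eigen p_L2 P_repr]
  have "boundary_area \<Omega> powr (- 1 / 2) * (1 / sqrt (q j) * h j x * w j z) =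
      smooth_lap \<Omega> (b j) x * normal_deriv \<Omega> (b j) z" for j z
    using pos(1) pos(2)[of j]
    by (simp add: h w real_sqrt_mult powr_minus powr_half_sqrt field_simps)
  moreover have "1 / q j * DBS_lap \<Omega> (q j) (b j) x * DBS_lap \<Omega> (q j) (b j) z =
      smooth_lap \<Omega> (b j) x * normal_deriv \<Omega> (b j) z" if "z \<in> space (boundary_measure \<Omega>)" for j z
  proof -
    have "x \<notin> frontier \<Omega>"
      using region x by (simp add: region_def frontier_def interior_open)
    then show ?thesis
      using that pos(2)[of j] by (simp add: DBS_lap_def space_boundary_measure)
  qed
  ultimately show "(AE z in boundary_measure \<Omega>. P x z < \<infinity>) \<and>
     L2_sums (boundary_measure \<Omega>)
       (\<lambda>j z. boundary_area \<Omega> powr (- 1 / 2) * (1 / sqrt (q j) * h j x * w j z))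
       (\<lambda>z. enn2real (P x z)) \<and>
     L2_sums (boundary_measure \<Omega>)
       (\<lambda>j z. 1 / q j * DBS_lap \<Omega> (q j) (b j) x * DBS_lap \<Omega> (q j) (b j) z)
       (\<lambda>z. enn2real (P x z))"
    using P_AE expansion
    by (simp add: less_top[symmetric] cong: L2_sums_cong)
qed

end
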